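(* For any $\widetilde{\mathbf{E}},\widetilde{\mathbf{H}}\in\mathbb{P}_p(K)^3$ there is a unique $(\mathbf{E},\mathbf{H})\in\mathbb{T}_p(K\times I^n)$ with $\mathbf{E}(t^{n-1})=\widetilde{\mathbf{E}}$ and $\mathbf{H}(t^{n-1})=\widetilde{\mathbf{H}}$.
   Context: $K\subset\mathbb{R}^3$ is a polyhedral mesh element (with nonempty interior), $I^n=[t^{n-1},t^n]$ with $t^{n-1}<t^n$ is a time interval, $p\ge0$ is an integer, and $\epsilon,\mu>0$ are constants. $\mathbb{P}_p(D)$ denotes the real polynomials on $D\subset\mathbb{R}^d$ of total degree at most $p$. The space of Trefftz polynomials is $$\mathbb{T}_p(K\times I^n)=\{(\mathbf{E},\mathbf{H})\in\mathbb{P}_p(K\times I^n)^6:\ \epsilon\partial_t\mathbf{E}-\mathrm{curl}\,\mathbf{H}=0,\ \mu\partial_t\mathbf{H}+\mathrm{curl}\,\mathbf{E}=0\},$$ where $\mathbf{E},\mathbf{H}$ are $\mathbb{R}^3$-valued functions of $(x,t)\in K\times I^n$ and curl acts in $x$. *)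

theory Defs
  imports "HOL-Analysis.Analysis"
begin

text \<open>Up to boundary points, \<open>K\<close> is a finite union of full-dimensional polytopes; it need not be
  convex, and it may be open, closed, or contain only part of its boundary. In all cases every
  point of \<open>K\<close> lies in the closure of \<open>interior K\<close>.\<close>

definition polyhedral_element :: "'a::euclidean_space set \<Rightarrow> bool" where
  "polyhedral_element K \<longleftrightarrow>
     (\<exists>\<F>. finite \<F> \<and> (\<forall>P\<in>\<F>. polytope P \<and> interior P \<noteq> {}) \<and>
          interior (\<Union>\<F>) \<subseteq> K \<and> K \<subseteq> \<Union>\<F>)"

text \<open>Multi-indices are indexed by the coordinate directions \<open>Basis\<close>; outside \<open>Basis\<close> they are
  pinned to \<open>undefined\<close>, which makes the index set finite.\<close>

definition multi_indices :: "nat \<Rightarrow> ('a::euclidean_space \<Rightarrow> nat) set" where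
  "multi_indices p = {\<alpha> \<in> Basis \<rightarrow>\<^sub>E UNIV. (\<Sum>b\<in>Basis. \<alpha> b) \<le> p}"

lemma finite_multi_indices [simp]:
  "finite (multi_indices p :: ('a::euclidean_space \<Rightarrow> nat) set)"
proof (rule finite_subset)
  show "(multi_indices p :: ('a \<Rightarrow> nat) set) \<subseteq> Basis \<rightarrow>\<^sub>E {..p}"
  proof
    fix \<alpha> :: "'a \<Rightarrow> nat"
    assume \<alpha>: "\<alpha> \<in> multi_indices p"
    have "\<alpha> b \<le> p" if "b \<in> Basis" for b
      using member_le_sum[of b Basis \<alpha>] that \<alpha> by (auto simp: multi_indices_def)
    with \<alpha> show "\<alpha> \<in> Basis \<rightarrow>\<^sub>E {..p}"
      by (auto simp: multi_indices_def PiE_iff)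
  qed
  show "finite (Basis \<rightarrow>\<^sub>E {..p} :: ('a \<Rightarrow> nat) set)"
    by (intro finite_PiE) auto
qed

definition polynomial_on :: "nat \<Rightarrow> 'a::euclidean_space set \<Rightarrow> ('a \<Rightarrow> real) \<Rightarrow> bool" where
  "polynomial_on p D f \<longleftrightarrow>
     (\<exists>c. \<forall>x\<in>D. f x = (\<Sum>\<alpha>\<in>multi_indices p. c \<alpha> * (\<Prod>b\<in>Basis. (x \<bullet> b) ^ \<alpha> b)))"

text \<open>The space of polynomial vector fields on \<open>D\<close>. A function on \<open>D\<close> is represented
  extensionally, so that equality is equality of functions on \<open>D\<close>.\<close>

definition polynomial_fields :: "nat \<Rightarrow> 'a::euclidean_space set \<Rightarrow> ('a \<Rightarrow> real^3) set" where
  "polynomial_fields p D = {F \<in> extensional D. \<forall>i. polynomial_on p D (\<lambda>x. F x $ i)}"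

definition partial :: "3 \<Rightarrow> (real^3 \<Rightarrow> real^3) \<Rightarrow> real^3 \<Rightarrow> real^3" where
  "partial j F x = frechet_derivative F (at x) (axis j 1)"

definition curl :: "(real^3 \<Rightarrow> real^3) \<Rightarrow> real^3 \<Rightarrow> real^3" where
  "curl F x = vector
     [partial 2 F x $ 3 - partial 3 F x $ 2,
      partial 3 F x $ 1 - partial 1 F x $ 3,
      partial 1 F x $ 2 - partial 2 F x $ 1]"

text \<open>The differential equations are imposed in the interior of the space-time element, where the
  two-sided derivatives only see values of the fields inside the element. For polynomial fields
  on a polyhedral element they then extend to the boundary by continuity.\<close>

definition trefftz ::
  "real \<Rightarrow> real \<Rightarrow> nat \<Rightarrow> (real^3) set \<Rightarrow> real set \<Rightarrow>
     (((real^3) \<times> real \<Rightarrow> real^3) \<times> ((real^3) \<times> real \<Rightarrow> real^3)) set" where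
  "trefftz \<epsilon> \<mu> p K I =
     {(E, H). E \<in> polynomial_fields p (K \<times> I) \<and> H \<in> polynomial_fields p (K \<times> I) \<and>
        (\<forall>(x, t) \<in> interior (K \<times> I).
           \<epsilon> *\<^sub>R vector_derivative (\<lambda>s. E (x, s)) (at t) - curl (\<lambda>y. H (y, t)) x = 0 \<and>
           \<mu> *\<^sub>R vector_derivative (\<lambda>s. H (x, s)) (at t) + curl (\<lambda>y. E (y, t)) x = 0)}"

end

theory Submission
  imports Defs
begin

text \<open>Expanding the fields in powers of \<open>t - t0\<close>, with coefficient fields \<open>A k\<close> and \<open>B k\<close> on space,
  turns the differential equations into the recursion \<open>\<epsilon> (k + 1) A (k + 1) = curl (B k)\<close>,
  \<open>\<mu> (k + 1) B (k + 1) = - curl (A k)\<close> on \<open>interior K\<close>. Existence: the recursion can be solved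
  from any initial fields, and since \<open>curl\<close> lowers the degree, the solution terminates at
  \<open>k = p\<close> and \<open>(t - t0) ^ k A k\<close> keeps total degree at most \<open>p\<close>. Uniqueness: the initial fields
  determine all coefficients on the open set \<open>interior K\<close>, and by continuity on \<open>K\<close>, which lies
  in the closure of its interior.\<close>

section \<open>Closure properties of polynomials of bounded total degree\<close>

abbreviation monomial_at :: "('a::euclidean_space \<Rightarrow> nat) \<Rightarrow> 'a \<Rightarrow> real" where
  "monomial_at \<alpha> x \<equiv> (\<Prod>b\<in>Basis. (x \<bullet> b) ^ \<alpha> b)"

text \<open>The same coefficients define a polynomial on the whole space. Calculus can therefore be
  done on \<open>UNIV\<close>, with the restriction to \<open>D\<close> postponed.\<close>

lemma polynomial_on_iff_UNIV:
  "polynomial_on p D f \<longleftrightarrow> (\<exists>g. polynomial_on p UNIV g \<and> (\<forall>x\<in>D. f x = g x))"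
  unfolding polynomial_on_def by fastforce

lemma polynomial_on_add:
  assumes "polynomial_on p D f" "polynomial_on p D g"
  shows "polynomial_on p D (\<lambda>x. f x + g x)"
proof -
  obtain c d where "\<forall>x\<in>D. f x = (\<Sum>\<alpha>\<in>multi_indices p. c \<alpha> * monomial_at \<alpha> x)"
    and "\<forall>x\<in>D. g x = (\<Sum>\<alpha>\<in>multi_indices p. d \<alpha> * monomial_at \<alpha> x)"
    using assms unfolding polynomial_on_def by blast
  then show ?thesis
    unfolding polynomial_on_def
    by (intro exI[of _ "\<lambda>\<alpha>. c \<alpha> + d \<alpha>"]) (simp add: distrib_right sum.distrib)
qed

lemma polynomial_on_cmult:
  assumes "polynomial_on p D f"
  shows "polynomial_on p D (\<lambda>x. a * f x)"
proof -
  obtain c where "\<forall>x\<in>D. f x = (\<Sum>\<alpha>\<in>multi_indices p. c \<alpha> * monomial_at \<alpha> x)"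
    using assms unfolding polynomial_on_def by blast
  then show ?thesis
    unfolding polynomial_on_def
    by (intro exI[of _ "\<lambda>\<alpha>. a * c \<alpha>"]) (simp add: sum_distrib_left mult.assoc)
qed

lemma polynomial_on_monomial:
  assumes "\<alpha> \<in> multi_indices p"
  shows "polynomial_on p D (monomial_at \<alpha>)"
  unfolding polynomial_on_def
proof (intro exI[of _ "\<lambda>\<beta>. if \<beta> = \<alpha> then 1 else 0"] ballI)
  fix x
  have "(\<Sum>\<beta>\<in>multi_indices p. (if \<beta> = \<alpha> then 1 else 0) * monomial_at \<beta> x)
      = (\<Sum>\<beta>\<in>multi_indices p. if \<beta> = \<alpha> then monomial_at \<alpha> x else 0)"
    by (intro sum.cong) auto
  then show "monomial_at \<alpha> x
      = (\<Sum>\<beta>\<in>multi_indices p. (if \<beta> = \<alpha> then 1 else 0) * monomial_at \<beta> x)"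
    using assms by simp
qed

lemma polynomial_on_const: "polynomial_on p D (\<lambda>_. a)"
proof -
  \<comment> \<open>The zero multi-index is restricted to \<open>Basis\<close> because members of
    \<open>multi_indices\<close> are \<open>undefined\<close> elsewhere.\<close>
  have "polynomial_on p D (monomial_at (\<lambda>b\<in>Basis. 0))"
    by (intro polynomial_on_monomial) (auto simp: multi_indices_def PiE_iff extensional_def)
  then have "polynomial_on p D (\<lambda>_. 1)"
    by simp
  from polynomial_on_cmult[OF this, of a] show ?thesis
    by simp
qed

lemma polynomial_on_sum:
  assumes "\<And>i. i \<in> I \<Longrightarrow> polynomial_on p D (f i)"
  shows "polynomial_on p D (\<lambda>x. \<Sum>i\<in>I. f i x)"
  using assms
  by (induction I rule: infinite_finite_induct)
    (auto intro!: polynomial_on_const polynomial_on_add)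

lemma polynomial_on_mult_coordinate:
  assumes f: "polynomial_on p D f" and b: "b \<in> Basis"
  shows "polynomial_on (Suc p) D (\<lambda>x. (x \<bullet> b) * f x)"
proof -
  obtain c where c: "\<forall>x\<in>D. f x = (\<Sum>\<alpha>\<in>multi_indices p. c \<alpha> * monomial_at \<alpha> x)"
    using f unfolding polynomial_on_def by blast
  have mono: "(x \<bullet> b) * monomial_at \<alpha> x = monomial_at (\<alpha>(b := Suc (\<alpha> b))) x" for \<alpha> and x :: 'a
    using b by (simp add: prod.remove[of Basis b])
  have "polynomial_on (Suc p) D (\<lambda>x. \<Sum>\<alpha>\<in>multi_indices p. c \<alpha> * monomial_at (\<alpha>(b := Suc (\<alpha> b))) x)"
  proof (intro polynomial_on_sum polynomial_on_cmult polynomial_on_monomial)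
    fix \<alpha> :: "'a \<Rightarrow> nat"
    assume "\<alpha> \<in> multi_indices p"
    with b show "\<alpha>(b := Suc (\<alpha> b)) \<in> multi_indices (Suc p)"
      by (auto simp: multi_indices_def PiE_iff extensional_def sum.remove[of Basis b])
  qed
  moreover have "(x \<bullet> b) * f x
      = (\<Sum>\<alpha>\<in>multi_indices p. c \<alpha> * monomial_at (\<alpha>(b := Suc (\<alpha> b))) x)" if "x \<in> D" for x
    using c that by (simp add: sum_distrib_left mult.left_commute mono del: fun_upd_apply)
  ultimately show ?thesis
    unfolding polynomial_on_def by auto
qed

section \<open>Induction over polynomials and their derivatives\<close>

text \<open>A monomial with a positive exponent is a coordinate times a monomial of one degree less,
  and a polynomial is a finite sum of such terms. The predicate carries the degree bound, since
  \<open>mult\<close> raises it. Later proofs thus avoid multi-indices.\<close>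

lemma polynomial_on_UNIV_induct [consumes 1, case_names const add mult]:
  fixes f :: "'a::euclidean_space \<Rightarrow> real"
  assumes "polynomial_on p UNIV f"
    and const: "\<And>p a. P p (\<lambda>_. a)"
    and add: "\<And>p f g. polynomial_on p UNIV f \<Longrightarrow> polynomial_on p UNIV g \<Longrightarrow>
      P p f \<Longrightarrow> P p g \<Longrightarrow> P p (\<lambda>x. f x + g x)"
    and mult: "\<And>p f b. polynomial_on p UNIV f \<Longrightarrow> b \<in> Basis \<Longrightarrow> P p f \<Longrightarrow>
      P (Suc p) (\<lambda>x. (x \<bullet> b) * f x)"
  shows "P p f"
proof -
  have monomial: "P p (\<lambda>x. a * monomial_at \<alpha> x)" if "\<alpha> \<in> multi_indices p" for \<alpha> p a
    using that
  proof (induction p arbitrary: \<alpha>)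
    case 0
    then have "monomial_at \<alpha> x = 1" for x
      by (simp add: multi_indices_def)
    then show ?case
      using const by simp
  next
    case (Suc p)
    show ?case
    proof (cases "\<forall>b\<in>Basis. \<alpha> b = 0")
      case True
      then have "monomial_at \<alpha> x = 1" for x
        by simp
      then show ?thesis
        using const by simp
    next
      case False
      then obtain b where b: "b \<in> Basis" "\<alpha> b > 0"
        by auto
      define \<beta> where "\<beta> = \<alpha>(b := \<alpha> b - 1)"
      have \<beta>: "\<beta> \<in> multi_indices p"
        using Suc.prems b
        by (auto simp: \<beta>_def multi_indices_def PiE_iff extensional_def sum.remove[of Basis b])
      have eq: "(\<lambda>x. a * monomial_at \<alpha> x) = (\<lambda>x. (x \<bullet> b) * (a * monomial_at \<beta> x))"
        using b by (simp add: \<beta>_def prod.remove[of Basis b] fun_eq_iff flip: power_Suc)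
      show ?thesis
        unfolding eq
        by (intro mult polynomial_on_cmult polynomial_on_monomial Suc.IH \<beta> b(1))
    qed
  qed
  obtain c where c: "\<And>x. f x = (\<Sum>\<alpha>\<in>multi_indices p. c \<alpha> * monomial_at \<alpha> x)"
    using assms(1) unfolding polynomial_on_def by blast
  \<comment> \<open>Adding one monomial at a time passes through partial sums, hence the arbitrary
    subset \<open>A\<close> of the index set.\<close>
  have "P p (\<lambda>x. \<Sum>\<alpha>\<in>A. c \<alpha> * monomial_at \<alpha> x)" if "finite A" "A \<subseteq> multi_indices p" for A
    using that
  proof (induction A rule: finite_induct)
    case empty
    then show ?case
      using const by simp
  next
    case (insert \<alpha> A)
    then have "polynomial_on p UNIV (\<lambda>x. c \<alpha> * monomial_at \<alpha> x)"
      and "polynomial_on p UNIV (\<lambda>x. \<Sum>\<alpha>\<in>A. c \<alpha> * monomial_at \<alpha> x)"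
      by (auto intro!: polynomial_on_sum polynomial_on_cmult polynomial_on_monomial)
    from add[OF this] insert monomial show ?case
      by simp
  qed
  from this[of "multi_indices p"] have "P p (\<lambda>x. \<Sum>\<alpha>\<in>multi_indices p. c \<alpha> * monomial_at \<alpha> x)"
    by simp
  also have "(\<lambda>x. \<Sum>\<alpha>\<in>multi_indices p. c \<alpha> * monomial_at \<alpha> x) = f"
    using c by auto
  finally show ?thesis .
qed

text \<open>Because \<open>p - 1\<close> is truncated, the vanishing of the derivative in degree \<open>0\<close> is a separate
  conclusion; it is what makes the coefficient recursion terminate.\<close>

lemma polynomial_on_has_derivative:
  assumes "polynomial_on p UNIV f"
  shows "\<exists>f'. (\<forall>x. (f has_derivative f' x) (at x)) \<and>
    (\<forall>v. polynomial_on (p - 1) UNIV (\<lambda>x. f' x v)) \<and> (p = 0 \<longrightarrow> (\<forall>x v. f' x v = 0))"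
  using assms
proof (induction rule: polynomial_on_UNIV_induct)
  case (const p a)
  then show ?case
    by (intro exI[of _ "\<lambda>_ _. 0"]) (auto intro: polynomial_on_const)
next
  case (add p f g)
  then obtain f' g' where
      "\<forall>x. (f has_derivative f' x) (at x)" "\<forall>v. polynomial_on (p - 1) UNIV (\<lambda>x. f' x v)"
      "p = 0 \<longrightarrow> (\<forall>x v. f' x v = 0)"
      "\<forall>x. (g has_derivative g' x) (at x)" "\<forall>v. polynomial_on (p - 1) UNIV (\<lambda>x. g' x v)"
      "p = 0 \<longrightarrow> (\<forall>x v. g' x v = 0)"
    by blast
  then show ?case
    by (intro exI[of _ "\<lambda>x v. f' x v + g' x v"])
      (auto intro!: polynomial_on_add has_derivative_add)
next
  case (mult p f b)
  then obtain f' where f': "\<And>x. (f has_derivative f' x) (at x)"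
      "\<And>v. polynomial_on (p - 1) UNIV (\<lambda>x. f' x v)" "p = 0 \<Longrightarrow> (\<forall>x v. f' x v = 0)"
    by blast
  have "polynomial_on p UNIV (\<lambda>x. (x \<bullet> b) * f' x v)" for v
  \<comment> \<open>Multiplying by a coordinate gives the bound \<open>Suc (p - 1)\<close>, which
    equals \<open>p\<close> only for positive \<open>p\<close>; in degree 0 the product vanishes
    with \<open>f'\<close>.\<close>
  proof (cases p)
    case 0
    then show ?thesis
      using f'(3) polynomial_on_const by simp
  next
    case (Suc q)
    then show ?thesis
      using polynomial_on_mult_coordinate[OF f'(2) mult(2)] by simp
  qed
  then have "polynomial_on p UNIV (\<lambda>x. (x \<bullet> b) * f' x v + (v \<bullet> b) * f x)" for v
    using mult by (intro polynomial_on_add polynomial_on_cmult)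
  moreover have "((\<lambda>x. (x \<bullet> b) * f x) has_derivative (\<lambda>v. (x \<bullet> b) * f' x v + (v \<bullet> b) * f x)) (at x)" for x
    using f'(1) by (auto intro!: derivative_eq_intros)
  ultimately show ?case
    by (intro exI[of _ "\<lambda>x v. (x \<bullet> b) * f' x v + (v \<bullet> b) * f x"]) auto
qed

section \<open>Polynomials on space-time and their expansion in time\<close>

lemma polynomial_on_fst:
  fixes f :: "'a::euclidean_space \<Rightarrow> real"
  assumes "polynomial_on p UNIV f"
  shows "polynomial_on p UNIV (\<lambda>z::'a \<times> 'b::euclidean_space. f (fst z))"
  using assms
proof (induction rule: polynomial_on_UNIV_induct)
  case (mult p f b)
  then have "(b, 0) \<in> (Basis :: ('a \<times> 'b) set)"
    by (simp add: Basis_prod_def)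
  from polynomial_on_mult_coordinate[OF mult(3) this] show ?case
    by (simp add: inner_prod_def)
qed (auto intro: polynomial_on_const polynomial_on_add)

lemma polynomial_on_mono:
  assumes "polynomial_on p D f" "p \<le> q"
  shows "polynomial_on q D f"
proof -
  obtain c where c: "\<forall>x\<in>D. f x = (\<Sum>\<alpha>\<in>multi_indices p. c \<alpha> * monomial_at \<alpha> x)"
    using assms unfolding polynomial_on_def by blast
  have "polynomial_on q D (\<lambda>x. \<Sum>\<alpha>\<in>multi_indices p. c \<alpha> * monomial_at \<alpha> x)"
    using assms(2)
    by (intro polynomial_on_sum polynomial_on_cmult polynomial_on_monomial)
      (auto simp: multi_indices_def)
  then show ?thesis
    using c unfolding polynomial_on_def by auto
qed

lemma polynomial_on_time_power_mult:
  fixes f :: "'a::euclidean_space \<times> real \<Rightarrow> real"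
  assumes "polynomial_on p UNIV f"
  shows "polynomial_on (k + p) UNIV (\<lambda>z. (snd z - t0) ^ k * f z)"
proof (induction k)
  case 0
  then show ?case
    using assms by simp
next
  case (Suc k)
  have "(0, 1) \<in> (Basis :: ('a \<times> real) set)"
    by (simp add: Basis_prod_def)
  from polynomial_on_mult_coordinate[OF Suc this]
  have "polynomial_on (Suc k + p) UNIV (\<lambda>z. snd z * ((snd z - t0) ^ k * f z))"
    by (simp add: inner_prod_def)
  \<comment> \<open>The new factor \<open>t - t0\<close> is split: the summand \<open>t\<close>
    raises the degree by one, and the summand \<open>- t0\<close> leaves it alone, so its bound is
    weakened to match.\<close>
  moreover have "polynomial_on (Suc k + p) UNIV (\<lambda>z. - t0 * ((snd z - t0) ^ k * f z))"
    using polynomial_on_mono[OF Suc] by (intro polynomial_on_cmult) simp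
  ultimately have "polynomial_on (Suc k + p) UNIV
      (\<lambda>z. snd z * ((snd z - t0) ^ k * f z) + - t0 * ((snd z - t0) ^ k * f z))"
    by (rule polynomial_on_add)
  then show ?case
    by (simp add: algebra_simps)
qed

text \<open>Induction on \<open>f\<close>: a spatial coordinate multiplies every coefficient, while
  the time coordinate mixes neighbouring ones. The bound \<open>p\<close> on each \<open>a k\<close>
  is coarser than \<open>p - k\<close> but already yields differentiability. Vanishing beyond
  \<open>p\<close> allows the range of summation to be extended.\<close>

lemma polynomial_on_time_expansion:
  fixes f :: "'a::euclidean_space \<times> real \<Rightarrow> real"
  assumes "polynomial_on p UNIV f"
  shows "\<exists>a. (\<forall>k. polynomial_on p UNIV (a k)) \<and> (\<forall>k>p. \<forall>x. a k x = 0) \<and>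
    (\<forall>x t. f (x, t) = (\<Sum>k\<le>p. (t - t0) ^ k * a k x))"
  using assms
proof (induction rule: polynomial_on_UNIV_induct)
  case (const p c)
  have "(\<Sum>k\<le>p. (t - t0) ^ k * (if k = 0 then c else 0)) = c" for t
  proof -
    have "(\<Sum>k\<le>p. (t - t0) ^ k * (if k = 0 then c else 0)) = (\<Sum>k\<le>p. if k = 0 then c else 0)"
      by (intro sum.cong) auto
    then show ?thesis
      by simp
  qed
  then show ?case
    by (intro exI[of _ "\<lambda>k _. if k = 0 then c else 0"]) (auto intro: polynomial_on_const)
next
  case (add p f g)
  then obtain a b where
      "\<forall>k. polynomial_on p UNIV (a k)" "\<forall>k>p. \<forall>x. a k x = 0"
      "\<forall>x t. f (x, t) = (\<Sum>k\<le>p. (t - t0) ^ k * a k x)"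
      "\<forall>k. polynomial_on p UNIV (b k)" "\<forall>k>p. \<forall>x. b k x = 0"
      "\<forall>x t. g (x, t) = (\<Sum>k\<le>p. (t - t0) ^ k * b k x)"
    by blast
  then show ?case
    by (intro exI[of _ "\<lambda>k x. a k x + b k x"])
      (auto intro: polynomial_on_add simp: distrib_left sum.distrib)
next
  case (mult p f b)
  then obtain a where a: "\<And>k. polynomial_on p UNIV (a k)" "\<And>k x. k > p \<Longrightarrow> a k x = 0"
      "\<And>x t. f (x, t) = (\<Sum>k\<le>p. (t - t0) ^ k * a k x)"
    by blast
  from mult(2) consider u where "b = (u, 0)" "u \<in> Basis" | "b = (0, 1)"
    by (auto simp: Basis_prod_def)
  then show ?case
  proof cases
    case 1
    with a show ?thesis
      by (intro exI[of _ "\<lambda>k x. (x \<bullet> u) * a k x"])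
        (auto intro: polynomial_on_mult_coordinate simp: sum_distrib_left mult.left_commute)
  next
    case 2
    \<comment> \<open>Writing \<open>t = t0 + (t - t0)\<close>, the first summand scales coefficient
      \<open>k\<close> by \<open>t0\<close> and the second moves coefficient \<open>k - 1\<close> up
      to place \<open>k\<close>.\<close>
    define c where "c k x = t0 * a k x + (case k of 0 \<Rightarrow> 0 | Suc j \<Rightarrow> a j x)" for k x
    have "polynomial_on (Suc p) UNIV (c k)" for k
      unfolding c_def using polynomial_on_mono[OF a(1), of "Suc p"]
      by (cases k) (auto intro!: polynomial_on_add polynomial_on_cmult polynomial_on_const)
    moreover have "c k x = 0" if "k > Suc p" for k x
      using that a(2) by (auto simp: c_def split: nat.split)
    moreover have "t * f (x, t) = (\<Sum>k\<le>Suc p. (t - t0) ^ k * c k x)" for x t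
    proof -
      have "(\<Sum>k\<le>Suc p. (t - t0) ^ k * c k x) = (\<Sum>k\<le>Suc p. (t - t0) ^ k * (t0 * a k x))
          + (\<Sum>k\<le>Suc p. (t - t0) ^ k * (case k of 0 \<Rightarrow> 0 | Suc j \<Rightarrow> a j x))"
        by (simp only: c_def distrib_left sum.distrib)
      also have "(\<Sum>k\<le>Suc p. (t - t0) ^ k * (t0 * a k x)) = t0 * f (x, t)"
        using a(2) by (simp add: a(3) sum_distrib_left mult.left_commute)
      also have "(\<Sum>k\<le>Suc p. (t - t0) ^ k * (case k of 0 \<Rightarrow> 0 | Suc j \<Rightarrow> a j x))
          = (t - t0) * f (x, t)"
        by (simp add: a(3) sum.atMost_Suc_shift sum_distrib_left mult.assoc del: sum.atMost_Suc)
      finally show ?thesis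
        by (simp add: algebra_simps)
    qed
    ultimately show ?thesis
      using 2 by (intro exI[of _ c]) simp
  qed
qed


section \<open>Polynomial vector fields and their curl\<close>

abbreviation polynomial_field :: "nat \<Rightarrow> ('a::euclidean_space \<Rightarrow> real^3) \<Rightarrow> bool" where
  "polynomial_field p F \<equiv> \<forall>i. polynomial_on p UNIV (\<lambda>x. F x $ i)"

text \<open>Every field on \<open>D\<close> gets a global polynomial representative, whose
  derivatives exist at all points, including those on the boundary of \<open>D\<close>.\<close>

lemma polynomial_fields_eq: "polynomial_fields p D = {restrict F D |F. polynomial_field p F}"
proof (intro equalityI subsetI)
  fix F :: "'a \<Rightarrow> real^3"
  assume F: "F \<in> polynomial_fields p D"
  then have "\<forall>i. \<exists>g. polynomial_on p UNIV g \<and> (\<forall>x\<in>D. F x $ i = g x)"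
    by (simp add: polynomial_fields_def flip: polynomial_on_iff_UNIV)
  then obtain g where g: "\<And>i. polynomial_on p UNIV (g i)" "\<And>i x. x \<in> D \<Longrightarrow> F x $ i = g i x"
    by metis
  have "F = restrict (\<lambda>x. \<chi> i. g i x) D"
    using F g(2) by (intro extensionalityI[of F D]) (auto simp: polynomial_fields_def vec_eq_iff)
  with g(1) show "F \<in> {restrict F D |F. polynomial_field p F}"
    by auto
next
  fix F :: "'a \<Rightarrow> real^3"
  assume "F \<in> {restrict F D |F. polynomial_field p F}"
  then show "F \<in> polynomial_fields p D"
    unfolding polynomial_fields_def polynomial_on_iff_UNIV[of p D] by auto
qed

lemma polynomial_field_has_derivative:
  fixes F :: "'a::euclidean_space \<Rightarrow> real^3"
  assumes "polynomial_field p F"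
  shows "\<exists>F'. (\<forall>x. (F has_derivative F' x) (at x)) \<and>
    (\<forall>v. polynomial_field (p - 1) (\<lambda>x. F' x v)) \<and> (p = 0 \<longrightarrow> (\<forall>x v. F' x v = 0))"
proof -
  have "\<forall>i. \<exists>f'. (\<forall>x. ((\<lambda>x. F x $ i) has_derivative f' x) (at x)) \<and>
    (\<forall>v. polynomial_on (p - 1) UNIV (\<lambda>x. f' x v)) \<and> (p = 0 \<longrightarrow> (\<forall>x v. f' x v = 0))"
    using assms polynomial_on_has_derivative by blast
  then obtain f' where f': "\<And>i x. ((\<lambda>x. F x $ i) has_derivative f' i x) (at x)"
    "\<And>i v. polynomial_on (p - 1) UNIV (\<lambda>x. f' i x v)"
    "\<And>i x v. p = 0 \<Longrightarrow> f' i x v = 0"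
    by metis
  have "(F has_derivative (\<lambda>v. \<chi> i. f' i x v)) (at x)" for x
    using f'(1) by (subst has_derivative_componentwise_within) (auto simp: Basis_vec_def inner_axis)
  with f'(2,3) show ?thesis
    by (intro exI[of _ "\<lambda>x v. \<chi> i. f' i x v"]) (simp add: vec_eq_iff)
qed

lemma polynomial_field_differentiable:
  "polynomial_field p F \<Longrightarrow> F differentiable at x"
  using polynomial_field_has_derivative unfolding differentiable_def by blast

lemma partial_eq: "(F has_derivative F') (at x) \<Longrightarrow> partial j F x = F' (axis j 1)"
  unfolding partial_def using frechet_derivative_at by metis

lemma polynomial_field_partial:
  assumes "polynomial_field p F"
  shows "polynomial_field (p - 1) (partial j F)" and "p = 0 \<Longrightarrow> partial j F x = 0"
proof -
  obtain F' where F': "\<And>x. (F has_derivative F' x) (at x)"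
      "\<And>v. polynomial_field (p - 1) (\<lambda>x. F' x v)" "p = 0 \<Longrightarrow> (\<forall>x v. F' x v = 0)"
    using polynomial_field_has_derivative[OF assms] by blast
  have "partial j F = (\<lambda>x. F' x (axis j 1))"
    using partial_eq[OF F'(1)] by blast
  with F'(2,3) show "polynomial_field (p - 1) (partial j F)" "p = 0 \<Longrightarrow> partial j F x = 0"
    by auto
qed

lemma polynomial_field_curl:
  assumes "polynomial_field p F"
  shows "polynomial_field (p - 1) (curl F)"
proof -
  have diff: "polynomial_on (p - 1) UNIV (\<lambda>x. partial i F x $ j - partial k F x $ l)" for i j k l
    using polynomial_on_add[OF spec[OF polynomial_field_partial(1)[OF assms, of i], of j]
      polynomial_on_cmult[OF spec[OF polynomial_field_partial(1)[OF assms, of k], of l], of "-1"]]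
    by simp
  then show ?thesis
    unfolding forall_3 curl_def by simp
qed

text \<open>This ends the coefficient recursion: the coefficients at \<open>k = p\<close> have
  degree 0, so those at \<open>Suc p\<close> vanish.\<close>

lemma curl_constant_field: "polynomial_field 0 F \<Longrightarrow> curl F x = 0"
  by (simp add: curl_def polynomial_field_partial(2) vec_eq_iff forall_3)

lemma partial_sum_scaleR:
  assumes "\<And>k. k \<in> S \<Longrightarrow> B k differentiable at x"
  shows "partial j (\<lambda>y. \<Sum>k\<in>S. c k *\<^sub>R B k y) x = (\<Sum>k\<in>S. c k *\<^sub>R partial j (B k) x)"
proof -
  have "((\<lambda>y. \<Sum>k\<in>S. c k *\<^sub>R B k y) has_derivative
      (\<lambda>v. \<Sum>k\<in>S. c k *\<^sub>R frechet_derivative (B k) (at x) v)) (at x)"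
    using assms
    by (intro has_derivative_sum has_derivative_scaleR_right) (simp add: frechet_derivative_works)
  from partial_eq[OF this] show ?thesis
    by (simp add: partial_def)
qed

lemma curl_sum_scaleR:
  assumes "\<And>k. k \<in> S \<Longrightarrow> B k differentiable at x"
  shows "curl (\<lambda>y. \<Sum>k\<in>S. c k *\<^sub>R B k y) x = (\<Sum>k\<in>S. c k *\<^sub>R curl (B k) x)"
  using assms
  by (simp add: curl_def vec_eq_iff forall_3 partial_sum_scaleR right_diff_distrib sum_subtractf)

text \<open>Derivatives are local. This removes the restriction to the element, and it transfers
  curls between coefficients known to agree only on \<open>interior K\<close>.\<close>

lemma curl_cong_open:
  assumes "F differentiable at x" "open S" "x \<in> S" "\<And>y. y \<in> S \<Longrightarrow> F y = G y"
  shows "curl F x = curl G x"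
proof -
  have "frechet_derivative F (at x) = frechet_derivative G (at x)"
    using assms by (rule frechet_derivative_transform_within_open)
  then show ?thesis
    by (simp add: curl_def partial_def)
qed

section \<open>Polynomials in time with coefficient fields on space\<close>

text \<open>Centring the expansion at the initial time makes \<open>A 0\<close> the initial
  field.\<close>

definition time_series ::
  "nat \<Rightarrow> real \<Rightarrow> (nat \<Rightarrow> 'a \<Rightarrow> real^3) \<Rightarrow> 'a \<times> real \<Rightarrow> real^3" where
  "time_series p t0 A = (\<lambda>(x, t). \<Sum>k\<le>p. (t - t0) ^ k *\<^sub>R A k x)"

lemma time_series_initial: "time_series p t0 A (x, t0) = A 0 x"
proof -
  have "time_series p t0 A (x, t0) = (\<Sum>k\<le>p. if k = 0 then A 0 x else 0)"
    unfolding time_series_def prod.case by (intro sum.cong) auto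
  then show ?thesis
    by simp
qed

text \<open>Term \<open>k\<close> spends \<open>k\<close> degrees on time and leaves
  \<open>p - k\<close> for space.\<close>

lemma polynomial_field_time_series:
  fixes A :: "nat \<Rightarrow> 'a::euclidean_space \<Rightarrow> real^3"
  assumes "\<And>k. k \<le> p \<Longrightarrow> polynomial_field (p - k) (A k)"
  shows "polynomial_field p (time_series p t0 A)"
proof
  fix i
  have "polynomial_on p UNIV (\<lambda>z. (snd z - t0) ^ k * A k (fst z) $ i)" if "k \<le> p" for k
    using polynomial_on_time_power_mult[OF polynomial_on_fst[OF spec[OF assms[OF that], of i]],
        of k t0] that by simp
  then have "polynomial_on p UNIV (\<lambda>z. \<Sum>k\<le>p. (snd z - t0) ^ k * A k (fst z) $ i)"
    by (intro polynomial_on_sum) simp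
  then show "polynomial_on p UNIV (\<lambda>z. time_series p t0 A z $ i)"
    by (simp add: time_series_def case_prod_beta)
qed

lemma polynomial_field_time_expansion:
  fixes F :: "'a::euclidean_space \<times> real \<Rightarrow> real^3"
  assumes "polynomial_field p F"
  shows "\<exists>A. (\<forall>k. polynomial_field p (A k)) \<and> (\<forall>x. A (Suc p) x = 0) \<and> F = time_series p t0 A"
proof -
  have "\<forall>i. \<exists>a. (\<forall>k. polynomial_on p UNIV (a k)) \<and> (\<forall>k>p. \<forall>x. a k x = 0) \<and>
    (\<forall>x t. F (x, t) $ i = (\<Sum>k\<le>p. (t - t0) ^ k * a k x))"
    using assms polynomial_on_time_expansion by blast
  then obtain a where a: "\<And>i k. polynomial_on p UNIV (a i k)" "\<And>i k x. k > p \<Longrightarrow> a i k x = 0"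
    "\<And>i x t. F (x, t) $ i = (\<Sum>k\<le>p. (t - t0) ^ k * a i k x)"
    by metis
  have "F z = time_series p t0 (\<lambda>k x. \<chi> i. a i k x) z" for z
    by (cases z) (simp add: time_series_def vec_eq_iff a(3))
  with a(1,2) show ?thesis
    by (intro exI[of _ "\<lambda>k x. \<chi> i. a i k x"]) (simp add: vec_eq_iff fun_eq_iff)
qed

lemma vector_derivative_time_series:
  assumes "A (Suc p) x = 0"
  shows "vector_derivative (\<lambda>s. time_series p t0 A (x, s)) (at t)
    = (\<Sum>k\<le>p. (t - t0) ^ k *\<^sub>R real (Suc k) *\<^sub>R A (Suc k) x)"
proof (rule vector_derivative_at)
  let ?d = "\<Sum>k\<le>p. (real k * (t - t0) ^ (k - 1)) *\<^sub>R A k x"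
  have "((\<lambda>s. (s - t0) ^ k *\<^sub>R a) has_vector_derivative (real k * (t - t0) ^ (k - 1)) *\<^sub>R a) (at t)"
    for k and a :: "real^3"
  proof -
    have "((\<lambda>s. (s - t0) ^ k) has_real_derivative real k * (t - t0) ^ (k - 1)) (at t)"
      by (auto intro!: derivative_eq_intros)
    from has_derivative_scaleR_left[OF this[unfolded has_field_derivative_def], of a] show ?thesis
      by (simp add: has_vector_derivative_def mult.commute)
  qed
  then have "((\<lambda>s. time_series p t0 A (x, s)) has_vector_derivative ?d) (at t)"
    unfolding time_series_def prod.case by (intro has_vector_derivative_sum)
  \<comment> \<open>Appending the vanishing term \<open>Suc p\<close> lets the sum, after the shift
    below, run over \<open>k \<le> p\<close> again, the same range as for the curl.\<close>
  also have "?d = (\<Sum>k\<le>Suc p. (real k * (t - t0) ^ (k - 1)) *\<^sub>R A k x)"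
    using assms by simp
  \<comment> \<open>The term \<open>k = 0\<close> carries the factor 0 and drops out; the others
    move down by one.\<close>
  also have "\<dots> = (\<Sum>k\<le>p. (t - t0) ^ k *\<^sub>R real (Suc k) *\<^sub>R A (Suc k) x)"
    by (subst sum.atMost_Suc_shift) (simp add: mult.commute)
  finally show "((\<lambda>s. time_series p t0 A (x, s)) has_vector_derivative
    (\<Sum>k\<le>p. (t - t0) ^ k *\<^sub>R real (Suc k) *\<^sub>R A (Suc k) x)) (at t)" .
qed

text \<open>Pairing with a fixed vector \<open>v\<close> gives a real polynomial with infinitely
  many roots, so all its coefficients \<open>c k \<bullet> v\<close> vanish; \<open>v = c k\<close>
  then gives \<open>c k = 0\<close>.\<close>

lemma sum_powers_scaleR_eq_0_iff:
  fixes c :: "nat \<Rightarrow> 'a::real_inner"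
  assumes "a < b"
  shows "(\<forall>t\<in>{a<..<b}. (\<Sum>k\<le>p. (t - t0) ^ k *\<^sub>R c k) = 0) \<longleftrightarrow> (\<forall>k\<le>p. c k = 0)"
proof
  assume zero: "\<forall>t\<in>{a<..<b}. (\<Sum>k\<le>p. (t - t0) ^ k *\<^sub>R c k) = 0"
  have "c k \<bullet> v = 0" if "k \<le> p" for k v
  proof -
    have "(\<lambda>t. t - t0) ` {a<..<b} \<subseteq> {s. (\<Sum>k\<le>p. (c k \<bullet> v) * s ^ k) = 0}"
    proof clarify
      fix t assume "t \<in> {a<..<b}"
      with zero have "(\<Sum>k\<le>p. (t - t0) ^ k *\<^sub>R c k) \<bullet> v = 0"
        by simp
      then show "(\<Sum>k\<le>p. (c k \<bullet> v) * (t - t0) ^ k) = 0"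
        by (simp add: inner_sum_left mult.commute)
    qed
    moreover have "infinite ((\<lambda>t. t - t0) ` {a<..<b})"
      using assms by (subst finite_image_iff) (auto simp: inj_on_def infinite_Ioo)
    ultimately have "\<not> finite {s. (\<Sum>k\<le>p. (c k \<bullet> v) * s ^ k) = 0}"
      using finite_subset by blast
    with that show ?thesis
      using polyfun_finite_roots[of "\<lambda>k. c k \<bullet> v" p] by blast
  qed
  then show "\<forall>k\<le>p. c k = 0"
    by (metis inner_eq_zero_iff)
qed simp

section \<open>The differential equations as a recursion on coefficients\<close>

text \<open>At a fixed point of \<open>interior K\<close> both residuals are polynomials in time, so
  they vanish on the open interval exactly when each coefficient does. Existence reads this from
  right to left, uniqueness from left to right.\<close>

lemma trefftz_time_series_iff:
  fixes K :: "(real^3) set" and t0 t1 \<epsilon> \<mu> :: real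
  assumes A: "\<And>k x. A k differentiable at x" and B: "\<And>k x. B k differentiable at x"
    and zero: "\<And>x. A (Suc p) x = 0" "\<And>x. B (Suc p) x = 0" and "t0 < t1"
  defines "E \<equiv> restrict (time_series p t0 A) (K \<times> {t0..t1})"
    and "H \<equiv> restrict (time_series p t0 B) (K \<times> {t0..t1})"
  shows "(E, H) \<in> trefftz \<epsilon> \<mu> p K {t0..t1} \<longleftrightarrow>
    E \<in> polynomial_fields p (K \<times> {t0..t1}) \<and> H \<in> polynomial_fields p (K \<times> {t0..t1}) \<and>
    (\<forall>x\<in>interior K. \<forall>k\<le>p.
      (\<epsilon> * real (Suc k)) *\<^sub>R A (Suc k) x - curl (B k) x = 0 \<and>
      (\<mu> * real (Suc k)) *\<^sub>R B (Suc k) x + curl (A k) x = 0)"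
proof -
  have dt: "vector_derivative (\<lambda>s. restrict (time_series p t0 C) (K \<times> {t0..t1}) (x, s)) (at t)
      = (\<Sum>k\<le>p. (t - t0) ^ k *\<^sub>R real (Suc k) *\<^sub>R C (Suc k) x)"
    if "C (Suc p) x = 0" "x \<in> interior K" "t \<in> {t0<..<t1}" for C x t
  proof -
    \<comment> \<open>Near an interior time the restriction to the element is invisible to the
      derivative.\<close>
    have "\<forall>\<^sub>F s in nhds t. s \<in> {t0<..<t1}"
      using that by (intro eventually_nhds_in_open) auto
    then have "\<forall>\<^sub>F s in nhds t. s \<in> UNIV \<longrightarrow>
        restrict (time_series p t0 C) (K \<times> {t0..t1}) (x, s) = time_series p t0 C (x, s)"
      by (rule eventually_mono) (use that interior_subset in auto)
    from vector_derivative_cong_eq[OF this refl refl] that(1) show ?thesis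
      by (simp add: vector_derivative_time_series)
  qed
  have curl: "curl (\<lambda>y. restrict (time_series p t0 C) (K \<times> {t0..t1}) (y, t)) x
      = (\<Sum>k\<le>p. (t - t0) ^ k *\<^sub>R curl (C k) x)"
    if C: "\<And>k x. C k differentiable at x" and "x \<in> interior K" "t \<in> {t0<..<t1}" for C x t
  proof -
    have "curl (\<lambda>y. restrict (time_series p t0 C) (K \<times> {t0..t1}) (y, t)) x
        = curl (\<lambda>y. \<Sum>k\<le>p. (t - t0) ^ k *\<^sub>R C k y) x"
      using that interior_subset[of K]
      by (intro curl_cong_open[symmetric, where S = "interior K"] differentiable_sum)
        (auto simp: time_series_def)
    then show ?thesis
      by (simp add: curl_sum_scaleR C)
  qed
  have residual: "\<epsilon> *\<^sub>R vector_derivative (\<lambda>s. E (x, s)) (at t) - curl (\<lambda>y. H (y, t)) x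
      = (\<Sum>k\<le>p. (t - t0) ^ k *\<^sub>R ((\<epsilon> * real (Suc k)) *\<^sub>R A (Suc k) x - curl (B k) x))"
    "\<mu> *\<^sub>R vector_derivative (\<lambda>s. H (x, s)) (at t) + curl (\<lambda>y. E (y, t)) x
      = (\<Sum>k\<le>p. (t - t0) ^ k *\<^sub>R ((\<mu> * real (Suc k)) *\<^sub>R B (Suc k) x + curl (A k) x))"
    if "x \<in> interior K" "t \<in> {t0<..<t1}" for x t
    unfolding E_def H_def
      dt[of A, OF zero(1) that] dt[of B, OF zero(2) that] curl[of A, OF A that] curl[of B, OF B that]
    by (simp_all only: scaleR_diff_right scaleR_add_right scaleR_sum_right sum_subtractf sum.distrib
        scaleR_scaleR mult.left_commute)
  \<comment> \<open>The interior of the product is the product of the interiors, so the time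
    condition can be separated for each \<open>x\<close>.\<close>
  have "(E, H) \<in> trefftz \<epsilon> \<mu> p K {t0..t1} \<longleftrightarrow>
    E \<in> polynomial_fields p (K \<times> {t0..t1}) \<and> H \<in> polynomial_fields p (K \<times> {t0..t1}) \<and>
    (\<forall>x\<in>interior K.
      (\<forall>t\<in>{t0<..<t1}. (\<Sum>k\<le>p. (t - t0) ^ k *\<^sub>R
        ((\<epsilon> * real (Suc k)) *\<^sub>R A (Suc k) x - curl (B k) x)) = 0) \<and>
      (\<forall>t\<in>{t0<..<t1}. (\<Sum>k\<le>p. (t - t0) ^ k *\<^sub>R
        ((\<mu> * real (Suc k)) *\<^sub>R B (Suc k) x + curl (A k) x)) = 0))"
    using residual by (auto simp: trefftz_def interior_Times)
  then show ?thesis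
    unfolding sum_powers_scaleR_eq_0_iff[OF \<open>t0 < t1\<close>] by blast
qed

section \<open>Uniqueness by comparison of coefficients\<close>

text \<open>A closed convex set with nonempty interior is the closure of that interior. This applies
  to each polytope of the decomposition, whose interior lies in \<open>interior K\<close>.\<close>

lemma polyhedral_element_subset_closure_interior:
  assumes "polyhedral_element K"
  shows "K \<subseteq> closure (interior K)"
proof -
  obtain \<F> where F: "\<And>P. P \<in> \<F> \<Longrightarrow> polytope P \<and> interior P \<noteq> {}"
      "interior (\<Union>\<F>) \<subseteq> K" "K \<subseteq> \<Union>\<F>"
    using assms unfolding polyhedral_element_def by blast
  have "P \<subseteq> closure (interior K)" if "P \<in> \<F>" for P
  proof -
    have "P = closure (interior P)"
      using F(1)[OF that] convex_closure_interior polytope_imp_closed polytope_imp_convex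
      by (metis closure_closed)
    also have "\<dots> \<subseteq> closure (interior (\<Union>\<F>))"
      using that by (intro closure_mono interior_mono) auto
    also have "\<dots> \<subseteq> closure (interior K)"
      using F(2) by (intro closure_mono interior_maximal) auto
    finally show ?thesis .
  qed
  with F(3) show ?thesis
    by blast
qed

lemma trefftz_unique:
  fixes K :: "(real^3) set"
  assumes K: "K \<subseteq> closure (interior K)" and "t0 < t1" "\<epsilon> \<noteq> 0" "\<mu> \<noteq> 0"
    and EH: "(E, H) \<in> trefftz \<epsilon> \<mu> p K {t0..t1}" and EH': "(E', H') \<in> trefftz \<epsilon> \<mu> p K {t0..t1}"
    and initial: "\<And>x. x \<in> K \<Longrightarrow> E (x, t0) = E' (x, t0)" "\<And>x. x \<in> K \<Longrightarrow> H (x, t0) = H' (x, t0)"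
  shows "E = E' \<and> H = H'"
proof -
  let ?D = "K \<times> {t0..t1}"
  \<comment> \<open>Of the polynomial structure of the coefficients only differentiability is
    kept.\<close>
  have expansion: "\<exists>A. (\<forall>k x. A k differentiable at x) \<and> (\<forall>x. A (Suc p) x = 0) \<and>
      F = restrict (time_series p t0 A) ?D" if "F \<in> polynomial_fields p ?D" for F
  proof -
    obtain G where G: "polynomial_field p G" "F = restrict G ?D"
      using \<open>F \<in> polynomial_fields p ?D\<close> unfolding polynomial_fields_eq by blast
    obtain A where "\<forall>k. polynomial_field p (A k)" "\<forall>x. A (Suc p) x = 0" "G = time_series p t0 A"
      using polynomial_field_time_expansion[OF G(1)] by blast
    with G(2) polynomial_field_differentiable show ?thesis
      by blast
  qed
  obtain A where A: "\<And>k x. A k differentiable at x" "\<And>x. A (Suc p) x = 0"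
      and E: "E = restrict (time_series p t0 A) ?D"
    using expansion[of E] EH unfolding trefftz_def by blast
  obtain B where B: "\<And>k x. B k differentiable at x" "\<And>x. B (Suc p) x = 0"
      and H: "H = restrict (time_series p t0 B) ?D"
    using expansion[of H] EH unfolding trefftz_def by blast
  obtain A' where A': "\<And>k x. A' k differentiable at x" "\<And>x. A' (Suc p) x = 0"
      and E': "E' = restrict (time_series p t0 A') ?D"
    using expansion[of E'] EH' unfolding trefftz_def by blast
  obtain B' where B': "\<And>k x. B' k differentiable at x" "\<And>x. B' (Suc p) x = 0"
      and H': "H' = restrict (time_series p t0 B') ?D"
    using expansion[of H'] EH' unfolding trefftz_def by blast
  have rec: "(\<epsilon> * real (Suc k)) *\<^sub>R A (Suc k) x = curl (B k) x"
      "(\<mu> * real (Suc k)) *\<^sub>R B (Suc k) x = - curl (A k) x"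
      "(\<epsilon> * real (Suc k)) *\<^sub>R A' (Suc k) x = curl (B' k) x"
      "(\<mu> * real (Suc k)) *\<^sub>R B' (Suc k) x = - curl (A' k) x"
    if "x \<in> interior K" "k \<le> p" for k x
    using EH EH' that
    \<comment> \<open>The equations are brought into the residual form of the equivalence.\<close>
    unfolding eq_iff_diff_eq_0[of _ "curl _ _"] eq_neg_iff_add_eq_0
      E H E' H' trefftz_time_series_iff[of A B, OF A(1) B(1) A(2) B(2) \<open>t0 < t1\<close>]
      trefftz_time_series_iff[of A' B', OF A'(1) B'(1) A'(2) B'(2) \<open>t0 < t1\<close>]
    by blast+
  have coeffs: "\<forall>x\<in>interior K. A k x = A' k x \<and> B k x = B' k x" if "k \<le> p" for k
    using that
  proof (induction k)
    case 0
    show ?case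
    proof
      fix x assume "x \<in> interior K"
      then have "x \<in> K"
        using interior_subset by blast
      then show "A 0 x = A' 0 x \<and> B 0 x = B' 0 x"
        using initial[of x] \<open>t0 < t1\<close> by (simp add: E H E' H' time_series_initial)
    qed
  next
    case (Suc k)
    show ?case
    proof
      fix x assume x: "x \<in> interior K"
      \<comment> \<open>The induction hypothesis gives agreement on the whole open set
        \<open>interior K\<close>; agreement at \<open>x\<close> alone would not determine the
        curls.\<close>
      have "curl (A k) x = curl (A' k) x" "curl (B k) x = curl (B' k) x"
        using Suc x A(1) B(1) by (auto intro!: curl_cong_open[where S = "interior K"])
      then have "(\<epsilon> * real (Suc k)) *\<^sub>R A (Suc k) x = (\<epsilon> * real (Suc k)) *\<^sub>R A' (Suc k) x"
        "(\<mu> * real (Suc k)) *\<^sub>R B (Suc k) x = (\<mu> * real (Suc k)) *\<^sub>R B' (Suc k) x"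
        using rec[OF x, of k] Suc.prems by auto
      then show "A (Suc k) x = A' (Suc k) x \<and> B (Suc k) x = B' (Suc k) x"
        using \<open>\<epsilon> \<noteq> 0\<close> \<open>\<mu> \<noteq> 0\<close> by (simp del: of_nat_Suc)
    qed
  qed
  \<comment> \<open>At a fixed time the difference of the two series is continuous in space and
    vanishes on \<open>interior K\<close>, hence on the closure, which contains
    \<open>K\<close>.\<close>
  have eq: "restrict (time_series p t0 C) ?D = restrict (time_series p t0 C') ?D"
    if C: "\<And>k x. C k differentiable at x" "\<And>k x. C' k differentiable at x"
      and eq: "\<And>k x. k \<le> p \<Longrightarrow> x \<in> interior K \<Longrightarrow> C k x = C' k x"
    for C C' :: "nat \<Rightarrow> real^3 \<Rightarrow> real^3"
  proof (rule restrict_ext)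
    fix z assume "z \<in> ?D"
    then obtain x t where z: "z = (x, t)" "x \<in> closure (interior K)"
      using K by blast
    have "continuous_on S (C k)" "continuous_on S (C' k)" for S k
      using C by (auto intro!: continuous_at_imp_continuous_on differentiable_imp_continuous_within)
    then have "continuous_on (closure (interior K)) (\<lambda>x. \<Sum>k\<le>p. (t - t0) ^ k *\<^sub>R (C k x - C' k x))"
      by (intro continuous_intros)
    then have "(\<Sum>k\<le>p. (t - t0) ^ k *\<^sub>R (C k x - C' k x)) = 0"
      by (rule continuous_constant_on_closure) (use eq z in auto)
    then show "time_series p t0 C z = time_series p t0 C' z"
      by (simp add: time_series_def z scaleR_diff_right sum_subtractf)
  qed
  show ?thesis
    unfolding E H E' H' using coeffs by (intro conjI eq A(1) A'(1) B(1) B'(1)) auto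
qed

section \<open>Existence by solving the recursion\<close>

text \<open>The recursion is solved for its next term. Electric and magnetic coefficients form a
  pair because each step feeds the curl of one into the other.\<close>

primrec maxwell_coeffs ::
  "real \<Rightarrow> real \<Rightarrow> (real^3 \<Rightarrow> real^3) \<Rightarrow> (real^3 \<Rightarrow> real^3) \<Rightarrow> nat \<Rightarrow>
    (real^3 \<Rightarrow> real^3) \<times> (real^3 \<Rightarrow> real^3)" where
  "maxwell_coeffs \<epsilon> \<mu> F G 0 = (F, G)"
| "maxwell_coeffs \<epsilon> \<mu> F G (Suc k) =
    (\<lambda>x. (1 / (\<epsilon> * real (Suc k))) *\<^sub>R curl (snd (maxwell_coeffs \<epsilon> \<mu> F G k)) x,
     \<lambda>x. (- 1 / (\<mu> * real (Suc k))) *\<^sub>R curl (fst (maxwell_coeffs \<epsilon> \<mu> F G k)) x)"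

lemma polynomial_field_maxwell_coeffs:
  assumes "polynomial_field p F" "polynomial_field p G"
  shows "polynomial_field (p - k) (fst (maxwell_coeffs \<epsilon> \<mu> F G k)) \<and>
    polynomial_field (p - k) (snd (maxwell_coeffs \<epsilon> \<mu> F G k))"
proof (induction k)
  case (Suc k)
  have "polynomial_field (p - Suc k) (\<lambda>x. c *\<^sub>R curl C x)" if "polynomial_field (p - k) C" for c C
    using polynomial_field_curl[OF that] by (auto intro: polynomial_on_cmult)
  with Suc show ?case
    unfolding maxwell_coeffs.simps fst_conv snd_conv by blast
qed (use assms in auto)

lemma trefftz_exists:
  fixes K :: "(real^3) set"
  assumes "t0 < t1" "\<epsilon> \<noteq> 0" "\<mu> \<noteq> 0"
    and "E0 \<in> polynomial_fields p K" "H0 \<in> polynomial_fields p K"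
  shows "\<exists>E H. (E, H) \<in> trefftz \<epsilon> \<mu> p K {t0..t1} \<and>
    (\<forall>x\<in>K. E (x, t0) = E0 x \<and> H (x, t0) = H0 x)"
proof -
  let ?D = "K \<times> {t0..t1}"
  \<comment> \<open>The initial data are extended to all of space, so the recursion can be run
    there.\<close>
  obtain F G where F: "polynomial_field p F" "E0 = restrict F K"
    and G: "polynomial_field p G" "H0 = restrict G K"
    using assms unfolding polynomial_fields_eq by blast
  define A where "A k = fst (maxwell_coeffs \<epsilon> \<mu> F G k)" for k
  define B where "B k = snd (maxwell_coeffs \<epsilon> \<mu> F G k)" for k
  define E where "E = restrict (time_series p t0 A) ?D"
  define H where "H = restrict (time_series p t0 B) ?D"
  have poly: "polynomial_field (p - k) (A k)" "polynomial_field (p - k) (B k)" for k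
    using polynomial_field_maxwell_coeffs[OF F(1) G(1)] unfolding A_def B_def by blast+
  have rec: "A (Suc k) x = (1 / (\<epsilon> * real (Suc k))) *\<^sub>R curl (B k) x"
    "B (Suc k) x = (- 1 / (\<mu> * real (Suc k))) *\<^sub>R curl (A k) x" for k x
    by (simp_all add: A_def B_def)
  have diff: "A k differentiable at x" "B k differentiable at x" for k x
    using poly polynomial_field_differentiable by blast+
  \<comment> \<open>At \<open>k = p\<close> the bound \<open>p - k\<close> is 0, so the curls
    producing the next coefficients vanish.\<close>
  have last: "A (Suc p) x = 0" "B (Suc p) x = 0" for x
    using poly[of p] by (simp_all add: rec curl_constant_field)
  have "E \<in> polynomial_fields p ?D" "H \<in> polynomial_fields p ?D"
    using polynomial_field_time_series[of p] poly unfolding E_def H_def polynomial_fields_eq by blast+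
  moreover have "(\<epsilon> * real (Suc k)) *\<^sub>R A (Suc k) x - curl (B k) x = 0"
    "(\<mu> * real (Suc k)) *\<^sub>R B (Suc k) x + curl (A k) x = 0" for k x
    using assms(2,3) by (simp_all add: rec del: of_nat_Suc)
  ultimately have "(E, H) \<in> trefftz \<epsilon> \<mu> p K {t0..t1}"
    unfolding E_def H_def trefftz_time_series_iff[of A B, OF diff last \<open>t0 < t1\<close>] by blast
  moreover have "E (x, t0) = E0 x \<and> H (x, t0) = H0 x" if "x \<in> K" for x
    using that \<open>t0 < t1\<close> by (simp add: E_def H_def time_series_initial F(2) G(2) A_def B_def)
  ultimately show ?thesis
    by blast
qed

theorem theorem8:
  fixes K :: "(real^3) set" and t0 t1 \<epsilon> \<mu> :: real and p :: nat
    and E0 H0 :: "real^3 \<Rightarrow> real^3"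
  assumes "polyhedral_element K" and "interior K \<noteq> {}"
    and "t0 < t1" and "\<epsilon> > 0" and "\<mu> > 0"
    and "E0 \<in> polynomial_fields p K" and "H0 \<in> polynomial_fields p K"
  shows "\<exists>!EH. EH \<in> trefftz \<epsilon> \<mu> p K {t0..t1} \<and>
           (\<forall>x\<in>K. fst EH (x, t0) = E0 x) \<and> (\<forall>x\<in>K. snd EH (x, t0) = H0 x)"
proof (rule ex_ex1I)
  show "\<exists>EH. EH \<in> trefftz \<epsilon> \<mu> p K {t0..t1} \<and>
      (\<forall>x\<in>K. fst EH (x, t0) = E0 x) \<and> (\<forall>x\<in>K. snd EH (x, t0) = H0 x)"
    using trefftz_exists[of t0 t1 \<epsilon> \<mu> E0 p K H0] assms by fastforce
next
  fix X Y
  assume "X \<in> trefftz \<epsilon> \<mu> p K {t0..t1} \<and>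
      (\<forall>x\<in>K. fst X (x, t0) = E0 x) \<and> (\<forall>x\<in>K. snd X (x, t0) = H0 x)"
    and "Y \<in> trefftz \<epsilon> \<mu> p K {t0..t1} \<and>
      (\<forall>x\<in>K. fst Y (x, t0) = E0 x) \<and> (\<forall>x\<in>K. snd Y (x, t0) = H0 x)"
  \<comment> \<open>The polyhedral shape of \<open>K\<close> enters here, through the density of its
    interior in \<open>K\<close>.\<close>
  then show "X = Y"
    using trefftz_unique[OF polyhedral_element_subset_closure_interior[OF assms(1)] assms(3),
        of \<epsilon> \<mu> "fst X" "snd X" p "fst Y" "snd Y"] assms(4,5)
    by (simp add: prod_eq_iff)
qed

end
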